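(* Consider the receding horizon planning (RHP) scheme described in the context, with a nominal trajectory $(\bar{\bm x}_{-1}(\cdot),\bar{\bm u}_{-1}(\cdot))$, with terminal time $\bar t_f^{-1}$, that is feasible in the full horizon optimal control problem (P). Suppose that $\ell:\mathbb R^n\times\mathbb R^m\to\mathbb R$ is continuous and that there is $\varepsilon>0$ such that $\ell(\bm x,\bm u)\ge\varepsilon$ for all $(\bm x,\bm u)\in\mathcal X\times\mathcal U$. Then the terminal state $\bm x_f$ will be reached in finite time.
   Context: **System and full horizon problem (P).** Let $f:\mathbb R^n\times\mathbb R^m\to\mathbb R^n$, $\mathcal X\subseteq\mathbb R^n$, $\mathcal U\subseteq\mathbb R^m$, $\mathcal X_{\rm obst}\subset\mathbb R^n$, $\mathcal X_{\rm free}=\mathcal X\setminus\mathcal X_{\rm obst}$, initial time $t_0$, initial state $\bm x_0\in\mathcal X_{\rm free}$, terminal state $\bm x_f\in\mathcal X_{\rm free}$, and a cost function $\ell:\mathbb R^n\times\mathbb R^m\to\mathbb R$. Problem (P) is: minimize over control trajectories $\bm u(\cdot)$ and terminal times $t_f$ the functional $$J_{\rm tot}(\bm x_0,\bm u(\cdot))=\int_{t_0}^{t_f}\ell(\bm x(t),\bm u(t))\,\mathrm dt$$ subject to $\bm x(t_0)=\bm x_0$, $\bm x(t_f)=\bm x_f$, $\dot{\bm x}(t)=f(\bm x(t),\bm u(t))$, $\bm x(t)\in\mathcal X_{\rm free}$, $\bm u(t)\in\mathcal U$ for $t\in[t_0,t_f]$. A control/state trajectory with its terminal time is feasible in (P)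 if it satisfies these constraints. **RHP scheme.** A nominal trajectory $(\bar{\bm x}_{-1}(\cdot),\bar{\bm u}_{-1}(\cdot))$ on $[t_0,\bar t_f^{-1}]$ is given, satisfying $\bar{\bm x}_{-1}(\tau)=\bm x_0+\int_{t_0}^{\tau}f(\bar{\bm x}_{-1}(t),\bar{\bm u}_{-1}(t))\,\mathrm dt$. Fix $\delta>0$ and a horizon length $T\in(\delta,T_{\max}]$, and put $t_k=t_0+k\delta$, $k=0,1,2,\dots$. RHP iterations $k=0,1,2,\dots$ are performed as long as $t_k+T\le\bar t_f^{k-1}$; when $t_k+T>\bar t_f^{k-1}$ no further re-planning is performed and the last computed trajectory is followed to its end. At iteration $k$, given $(\bar{\bm x}_{k-1},\bar{\bm u}_{k-1},\bar t_f^{k-1})$, define the cost-to-go function $$\Psi_k(\tau)=\int_{\tau}^{\bar t_f^{k-1}}\ell(\bar{\bm x}_{k-1}(t),\bar{\bm u}_{k-1}(t))\,\mathrm dt,\qquad \tau\in[t_0,\bar t_f^{k-1}],$$ and solve the RHP problem: minimize over $\bm u_k(\cdot)$ on $[t_k,t_k+T]$ and $\tau_k\in[t_0,\bar t_f^{k-1}]$ $$J(\bar{\bm x}_{k-1}(t_k),\bm u_k(\cdot),\tau_k)=\Psi_k(\tau_k)+\int_{t_k}^{t_k+T}\ell(\bm x_k(t),\bm u_k(t))\,\mathrm dt$$ subject to $\bm x_k(t_k)=\bar{\bm x}_{k-1}(t_k)$, $\bm x_k(t_k+T)=\bar{\bm x}_{k-1}(\tau_k)$, $\dot{\bm x}_k(t)=f(\bm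 x_k(t),\bm u_k(t))$, $\bm x_k(t)\in\mathcal X_{\rm free}$, $\bm u_k(t)\in\mathcal U$ for $t\in[t_k,t_k+T]$. Let $(\bm u_k^\star(\cdot),\tau_k^\star)$ be an optimal solution of this RHP problem (assumed to exist), and set $\Delta t_k=\tau_k^\star-(t_k+T)$, $\bar t_f^{k}=\bar t_f^{k-1}-\Delta t_k$, and $$\bar{\bm u}_k(t)=\begin{cases}\bar{\bm u}_{k-1}(t), & t\in[t_0,t_k),\\ \bm u_k^\star(t), & t\in[t_k,t_k+T),\\ \bar{\bm u}_{k-1}(t+\Delta t_k), & t\in[t_k+T,\bar t_f^{k-1}-\Delta t_k],\end{cases}$$ with $\bar{\bm x}_k(\cdot)$ defined analogously (using the optimal state trajectory $\bm x_k^\star$ on $[t_k,t_k+T)$). The system executes $(\bar{\bm x}_k(t),\bar{\bm u}_k(t))$ on $[t_k,t_{k+1}]$ exactly (no model error or disturbance). *)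

theory Defs
  imports "HOL-Analysis.Analysis"
begin

text \<open>
  Controls on \<open>[a, b]\<close> are measurable and essentially bounded, and the differential equation is
  read in integral form (Caratheodory solutions). No uniqueness of solutions is assumed, so a
  state trajectory is always carried along with its control. All functions of time are total;
  only their values on the respective time interval matter.
\<close>

definition admissible_control :: "real \<Rightarrow> real \<Rightarrow> (real \<Rightarrow> real^'m) \<Rightarrow> bool" where
  "admissible_control a b u \<longleftrightarrow>
     u \<in> borel_measurable (lebesgue_on {a..b}) \<and>
     (\<exists>B. AE t in lebesgue_on {a..b}. norm (u t) \<le> B)"

definition solves_ode ::
  "((real^'n) \<times> (real^'m) \<Rightarrow> real^'n) \<Rightarrow> real \<Rightarrow> real \<Rightarrow> (real \<Rightarrow> real^'n) \<Rightarrow> (real \<Rightarrow> real^'m) \<Rightarrow> bool"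
where
  "solves_ode f a b x u \<longleftrightarrow>
     (\<lambda>t. f (x t, u t)) absolutely_integrable_on {a..b} \<and>
     (\<forall>\<tau>\<in>{a..b}. x \<tau> = x a + integral {a..\<tau>} (\<lambda>t. f (x t, u t)))"

definition admissible_trajectory ::
  "((real^'n) \<times> (real^'m) \<Rightarrow> real^'n) \<Rightarrow> (real^'n) set \<Rightarrow> (real^'m) set \<Rightarrow> real \<Rightarrow> real \<Rightarrow>
   (real \<Rightarrow> real^'n) \<Rightarrow> (real \<Rightarrow> real^'m) \<Rightarrow> bool"
where
  "admissible_trajectory f Xfree U a b x u \<longleftrightarrow>
     admissible_control a b u \<and> solves_ode f a b x u \<and>
     (\<forall>t\<in>{a..b}. x t \<in> Xfree \<and> u t \<in> U)"

definition running_cost ::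
  "((real^'n) \<times> (real^'m) \<Rightarrow> real) \<Rightarrow> real \<Rightarrow> real \<Rightarrow> (real \<Rightarrow> real^'n) \<Rightarrow> (real \<Rightarrow> real^'m) \<Rightarrow> real"
where
  "running_cost l a b x u = integral {a..b} (\<lambda>t. l (x t, u t))"

definition feasible_P ::
  "((real^'n) \<times> (real^'m) \<Rightarrow> real^'n) \<Rightarrow> (real^'n) set \<Rightarrow> (real^'m) set \<Rightarrow> real \<Rightarrow> real^'n \<Rightarrow> real^'n \<Rightarrow>
   (real \<Rightarrow> real^'n) \<Rightarrow> (real \<Rightarrow> real^'m) \<Rightarrow> real \<Rightarrow> bool"
where
  "feasible_P f Xfree U t\<^sub>0 x\<^sub>0 x\<^sub>f x u t\<^sub>f \<longleftrightarrow>
     t\<^sub>0 \<le> t\<^sub>f \<and> x t\<^sub>0 = x\<^sub>0 \<and> x t\<^sub>f = x\<^sub>f \<and> admissible_trajectory f Xfree U t\<^sub>0 t\<^sub>f x u"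

text \<open>
  The planning problem solved at time \<open>t\<^sub>k\<close>; \<open>(xp, up)\<close> on \<open>[t\<^sub>0, tfp]\<close> is the previous plan.
\<close>

definition cost_to_go ::
  "((real^'n) \<times> (real^'m) \<Rightarrow> real) \<Rightarrow> (real \<Rightarrow> real^'n) \<Rightarrow> (real \<Rightarrow> real^'m) \<Rightarrow> real \<Rightarrow> real \<Rightarrow> real"
where
  "cost_to_go l xp up tfp \<tau> = running_cost l \<tau> tfp xp up"

definition RHP_cost ::
  "((real^'n) \<times> (real^'m) \<Rightarrow> real) \<Rightarrow> (real \<Rightarrow> real^'n) \<Rightarrow> (real \<Rightarrow> real^'m) \<Rightarrow> real \<Rightarrow> real \<Rightarrow> real \<Rightarrow>
   (real \<Rightarrow> real^'n) \<Rightarrow> (real \<Rightarrow> real^'m) \<Rightarrow> real \<Rightarrow> real"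
where
  "RHP_cost l xp up tfp t\<^sub>k T x u \<tau> = cost_to_go l xp up tfp \<tau> + running_cost l t\<^sub>k (t\<^sub>k + T) x u"

definition RHP_feasible ::
  "((real^'n) \<times> (real^'m) \<Rightarrow> real^'n) \<Rightarrow> (real^'n) set \<Rightarrow> (real^'m) set \<Rightarrow> real \<Rightarrow>
   (real \<Rightarrow> real^'n) \<Rightarrow> real \<Rightarrow> real \<Rightarrow> real \<Rightarrow>
   (real \<Rightarrow> real^'n) \<Rightarrow> (real \<Rightarrow> real^'m) \<Rightarrow> real \<Rightarrow> bool"
where
  "RHP_feasible f Xfree U t\<^sub>0 xp tfp t\<^sub>k T x u \<tau> \<longleftrightarrow>
     \<tau> \<in> {t\<^sub>0..tfp} \<and> x t\<^sub>k = xp t\<^sub>k \<and> x (t\<^sub>k + T) = xp \<tau> \<and>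
     admissible_trajectory f Xfree U t\<^sub>k (t\<^sub>k + T) x u"

definition RHP_optimal ::
  "((real^'n) \<times> (real^'m) \<Rightarrow> real^'n) \<Rightarrow> ((real^'n) \<times> (real^'m) \<Rightarrow> real) \<Rightarrow> (real^'n) set \<Rightarrow> (real^'m) set \<Rightarrow>
   real \<Rightarrow> (real \<Rightarrow> real^'n) \<Rightarrow> (real \<Rightarrow> real^'m) \<Rightarrow> real \<Rightarrow> real \<Rightarrow> real \<Rightarrow>
   (real \<Rightarrow> real^'n) \<Rightarrow> (real \<Rightarrow> real^'m) \<Rightarrow> real \<Rightarrow> bool"
where
  "RHP_optimal f l Xfree U t\<^sub>0 xp up tfp t\<^sub>k T x u \<tau> \<longleftrightarrow>
     RHP_feasible f Xfree U t\<^sub>0 xp tfp t\<^sub>k T x u \<tau> \<and>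
     (\<forall>x' u' \<tau>'. RHP_feasible f Xfree U t\<^sub>0 xp tfp t\<^sub>k T x' u' \<tau>' \<longrightarrow>
        RHP_cost l xp up tfp t\<^sub>k T x u \<tau> \<le> RHP_cost l xp up tfp t\<^sub>k T x' u' \<tau>')"

definition splice :: "real \<Rightarrow> real \<Rightarrow> real \<Rightarrow> (real \<Rightarrow> 'a) \<Rightarrow> (real \<Rightarrow> 'a) \<Rightarrow> real \<Rightarrow> 'a" where
  "splice t\<^sub>k T \<Delta> old new t =
     (if t < t\<^sub>k then old t else if t < t\<^sub>k + T then new t else old (t + \<Delta>))"

definition RHP_step ::
  "((real^'n) \<times> (real^'m) \<Rightarrow> real^'n) \<Rightarrow> ((real^'n) \<times> (real^'m) \<Rightarrow> real) \<Rightarrow> (real^'n) set \<Rightarrow> (real^'m) set \<Rightarrow>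
   real \<Rightarrow> real \<Rightarrow> real \<Rightarrow>
   (real \<Rightarrow> real^'n) \<Rightarrow> (real \<Rightarrow> real^'m) \<Rightarrow> real \<Rightarrow>
   (real \<Rightarrow> real^'n) \<Rightarrow> (real \<Rightarrow> real^'m) \<Rightarrow> real \<Rightarrow> bool"
where
  "RHP_step f l Xfree U t\<^sub>0 t\<^sub>k T xp up tfp xn un tfn \<longleftrightarrow>
     (\<exists>x u \<tau>. RHP_optimal f l Xfree U t\<^sub>0 xp up tfp t\<^sub>k T x u \<tau> \<and>
        (let \<Delta> = \<tau> - (t\<^sub>k + T) in
           tfn = tfp - \<Delta> \<and> xn = splice t\<^sub>k T \<Delta> xp x \<and> un = splice t\<^sub>k T \<Delta> up u))"

definition plan_time :: "real \<Rightarrow> real \<Rightarrow> nat \<Rightarrow> real" where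
  "plan_time t\<^sub>0 \<delta> k = t\<^sub>0 + real k * \<delta>"

text \<open>
  The plans are numbered from \<open>0\<close>: index \<open>0\<close> is the nominal trajectory (subscript \<open>-1\<close> in the
  usual notation), and iteration \<open>k\<close> turns plan \<open>k\<close> into plan \<open>Suc k\<close>. Once the horizon exceeds
  the terminal time of the current plan, that plan is kept for ever; since the planning times
  increase, re-planning is then never resumed.
\<close>

definition RHP_run ::
  "((real^'n) \<times> (real^'m) \<Rightarrow> real^'n) \<Rightarrow> ((real^'n) \<times> (real^'m) \<Rightarrow> real) \<Rightarrow> (real^'n) set \<Rightarrow> (real^'m) set \<Rightarrow>
   real \<Rightarrow> real \<Rightarrow> real \<Rightarrow>
   (nat \<Rightarrow> real \<Rightarrow> real^'n) \<Rightarrow> (nat \<Rightarrow> real \<Rightarrow> real^'m) \<Rightarrow> (nat \<Rightarrow> real) \<Rightarrow> bool"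
where
  "RHP_run f l Xfree U t\<^sub>0 \<delta> T xbar ubar tf \<longleftrightarrow>
     (\<forall>k. if plan_time t\<^sub>0 \<delta> k + T \<le> tf k
          then RHP_step f l Xfree U t\<^sub>0 (plan_time t\<^sub>0 \<delta> k) T
                 (xbar k) (ubar k) (tf k) (xbar (Suc k)) (ubar (Suc k)) (tf (Suc k))
          else xbar (Suc k) = xbar k \<and> ubar (Suc k) = ubar k \<and> tf (Suc k) = tf k)"

text \<open>
  \<open>(x, u)\<close> is the motion of the closed-loop system: plan \<open>Suc k\<close> is executed from planning time
  \<open>k\<close> to planning time \<open>Suc k\<close>, but not beyond its end. The intervals are half-open because
  successive controls may differ at the planning time at which the plan is switched.
\<close>

definition RHP_executed ::
  "real \<Rightarrow> real \<Rightarrow> (nat \<Rightarrow> real \<Rightarrow> real^'n) \<Rightarrow> (nat \<Rightarrow> real \<Rightarrow> real^'m) \<Rightarrow> (nat \<Rightarrow> real) \<Rightarrow>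
   (real \<Rightarrow> real^'n) \<Rightarrow> (real \<Rightarrow> real^'m) \<Rightarrow> bool"
where
  "RHP_executed t\<^sub>0 \<delta> xbar ubar tf x u \<longleftrightarrow>
     (\<forall>k t. plan_time t\<^sub>0 \<delta> k \<le> t \<and> t < plan_time t\<^sub>0 \<delta> (Suc k) \<and> t \<le> tf (Suc k) \<longrightarrow>
        x t = xbar (Suc k) t \<and> u t = ubar (Suc k) t)"

end

(*
  The previous plan, reconnected to itself at tau = t_k + T, is a candidate for the planning problem
  at t_k; hence the total cost of the plans never increases, while every plan keeps ending in x_f.
  Since l >= eps, the total cost bounds the terminal times: tf k <= t_0 + J_0 / eps. The planning
  times t_k grow without bound, so re-planning stops. The last spliced plan ends at least T > delta
  after its planning time, so at its terminal time it is the plan being executed.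
*)
theory Submission
  imports Defs
begin

section \<open>Admissible controls under restriction, concatenation and time shift\<close>

text \<open>An essentially bounded measurable function on an interval of finite measure is
  integrable, and an integrable one is measurable. In this form the interval calculus of absolute
  integrability and explicit exceptional sets apply.\<close>

lemma admissible_control_iff:
  "admissible_control a b u \<longleftrightarrow>
     u absolutely_integrable_on {a..b} \<and>
     (\<exists>B N. negligible N \<and> (\<forall>t\<in>{a..b} - N. norm (u t) \<le> B))"
proof -
  have AE: "(AE t in lebesgue_on {a..b}. norm (u t) \<le> B) \<longleftrightarrow>
      (\<exists>N. negligible N \<and> (\<forall>t\<in>{a..b} - N. norm (u t) \<le> B))" for B
  proof -
    have "(AE t in lebesgue_on {a..b}. norm (u t) \<le> B) \<longleftrightarrow>
        (AE t in lebesgue. t \<in> {a..b} \<longrightarrow> norm (u t) \<le> B)"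
      by (rule AE_restrict_space_iff) simp
    also have "\<dots> \<longleftrightarrow> (\<exists>N. negligible N \<and> (\<forall>t\<in>{a..b} - N. norm (u t) \<le> B))"
      unfolding eventually_ae_filter negligible_iff_null_sets Bex_def by (intro ex_cong1) auto
    finally show ?thesis .
  qed
  have "integrable (lebesgue_on {a..b}) u"
    if "u \<in> borel_measurable (lebesgue_on {a..b})" "AE t in lebesgue_on {a..b}. norm (u t) \<le> B" for B
    using finite_measure.integrable_const_bound[OF finite_measure_lebesgue_on that(2,1)] by simp
  moreover have "u absolutely_integrable_on {a..b} \<longleftrightarrow> integrable (lebesgue_on {a..b}) u"
    unfolding set_integrable_def by (rule integrable_restrict_space[symmetric]) simp
  ultimately show ?thesis
    unfolding admissible_control_def using AE by (metis borel_measurable_integrable)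
qed

lemma absolutely_integrable_on_join:
  fixes g :: "real \<Rightarrow> 'a::euclidean_space"
  assumes "a \<le> b" "b \<le> c" "g absolutely_integrable_on {a..b}" "g absolutely_integrable_on {b..c}"
  shows "g absolutely_integrable_on {a..c}"
  using assms(3,4) unfolding absolutely_integrable_on_def
  by (intro conjI Henstock_Kurzweil_Integration.integrable_combine[OF assms(1,2)]) auto

lemma absolutely_integrable_on_shift:
  fixes g :: "real \<Rightarrow> 'a::euclidean_space"
  assumes "g absolutely_integrable_on {a..b}"
  shows "(\<lambda>t. g (t + c)) absolutely_integrable_on {a - c..b - c}"
  using assms integrable_shift_real_ivl_iff[of g c a b]
    integrable_shift_real_ivl_iff[of "\<lambda>t. norm (g t)" c a b]
  unfolding absolutely_integrable_on_def by simp

lemma admissible_control_subinterval: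
  assumes "admissible_control a b u" "a \<le> c" "d \<le> b"
  shows "admissible_control c d u"
proof -
  have "{c..d} \<subseteq> {a..b}" using assms by auto
  then show ?thesis
    using assms(1) absolutely_integrable_on_subinterval[of "{a..b}" u c d]
    unfolding admissible_control_iff by blast
qed

lemma admissible_control_join:
  assumes "a \<le> b" "b \<le> c" "admissible_control a b u" "admissible_control b c u"
  shows "admissible_control a c u"
proof -
  obtain B N B' N' where N: "negligible N" "\<forall>t\<in>{a..b} - N. norm (u t) \<le> B"
    and N': "negligible N'" "\<forall>t\<in>{b..c} - N'. norm (u t) \<le> B'"
    using assms(3,4) unfolding admissible_control_iff by blast
  have "norm (u t) \<le> max B B'" if "t \<in> {a..c} - (N \<union> N')" for t
  proof (cases "t \<le> b")
    case True
    then have "norm (u t) \<le> B" using that N(2) by auto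
    then show ?thesis by simp
  next
    case False
    then have "norm (u t) \<le> B'" using that N'(2) by auto
    then show ?thesis by simp
  qed
  moreover have "negligible (N \<union> N')" using N(1) N'(1) by (rule negligible_Un)
  moreover have "u absolutely_integrable_on {a..c}"
    using assms unfolding admissible_control_iff by (intro absolutely_integrable_on_join[of a b c]) auto
  ultimately show ?thesis unfolding admissible_control_iff by meson
qed

text \<open>The endpoint \<open>b\<close> joins the exceptional null set, so the control may change
  there. This fits \<open>splice\<close>, which switches controls at the right end of a half-open
  interval.\<close>

lemma admissible_control_cong:
  assumes "admissible_control a b u" "\<And>t. t \<in> {a..<b} \<Longrightarrow> u t = v t"
  shows "admissible_control a b v"
proof -
  obtain B N where N: "negligible N" "\<forall>t\<in>{a..b} - N. norm (u t) \<le> B"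
    using assms(1) unfolding admissible_control_iff by blast
  have "norm (v t) \<le> B" if "t \<in> {a..b} - insert b N" for t
    using that bspec[OF N(2), of t] assms(2)[of t] by auto
  moreover have "v absolutely_integrable_on {a..b}"
  proof (rule absolutely_integrable_spike)
    show "u absolutely_integrable_on {a..b}" using assms(1) unfolding admissible_control_iff by blast
    show "v t = u t" if "t \<in> {a..b} - {b}" for t using that assms(2)[of t] by auto
  qed simp
  moreover have "negligible (insert b N)" using N(1) by simp
  ultimately show ?thesis unfolding admissible_control_iff by meson
qed

lemma admissible_control_shift:
  assumes "admissible_control a b u"
  shows "admissible_control (a - c) (b - c) (\<lambda>t. u (t + c))"
proof -
  obtain B N where N: "negligible N" "\<forall>t\<in>{a..b} - N. norm (u t) \<le> B"
    using assms unfolding admissible_control_iff by blast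
  have "norm (u (t + c)) \<le> B" if "t \<in> {a - c..b - c} - (+) (- c) ` N" for t
  proof -
    have "t + c \<notin> N"
    proof
      assume "t + c \<in> N"
      then have "- c + (t + c) \<in> (+) (- c) ` N" by (rule imageI)
      then show False using that by simp
    qed
    then show ?thesis using that N(2) by auto
  qed
  moreover have "negligible ((+) (- c) ` N)" using N(1) by (rule negligible_translation)
  moreover have "(\<lambda>t. u (t + c)) absolutely_integrable_on {a - c..b - c}"
    using assms unfolding admissible_control_iff by (intro absolutely_integrable_on_shift) simp
  ultimately show ?thesis
    unfolding admissible_control_iff by (intro conjI exI[of _ B] exI[of _ "(+) (- c) ` N"]) auto
qed

section \<open>Solutions of the differential equation under the same operations\<close>

text \<open>In this orientation the integral equation is a terminating rewrite rule.\<close>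

lemma solves_ode_iff:
  fixes x :: "real \<Rightarrow> real^'n"
  shows
  "solves_ode f a b x u \<longleftrightarrow>
     (\<lambda>t. f (x t, u t)) absolutely_integrable_on {a..b} \<and>
     (\<forall>\<tau>\<in>{a..b}. integral {a..\<tau>} (\<lambda>t. f (x t, u t)) = x \<tau> - x a)"
proof -
  have *: "p = q + r \<longleftrightarrow> r = p - q" for p q r :: "real^'n" by auto
  show ?thesis unfolding solves_ode_def * ..
qed

lemma solves_ode_subinterval:
  assumes "solves_ode f a b x u" "a \<le> c" "d \<le> b"
  shows "solves_ode f c d x u"
proof -
  let ?g = "\<lambda>t. f (x t, u t)"
  have g: "?g absolutely_integrable_on {a..b}"
    and x: "\<And>\<sigma>. \<sigma> \<in> {a..b} \<Longrightarrow> integral {a..\<sigma>} ?g = x \<sigma> - x a"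
    using assms(1) unfolding solves_ode_iff by blast+
  have int: "?g absolutely_integrable_on {p..q}" if "a \<le> p" "q \<le> b" for p q
    using that by (intro absolutely_integrable_on_subinterval[OF g]) auto
  have "integral {c..\<sigma>} ?g = x \<sigma> - x c" if \<sigma>: "\<sigma> \<in> {c..d}" for \<sigma>
  proof -
    have "?g absolutely_integrable_on {a..\<sigma>}"
      using \<sigma> assms(3) by (intro int) auto
    then have comb: "integral {a..c} ?g + integral {c..\<sigma>} ?g = integral {a..\<sigma>} ?g"
      using assms(2) \<sigma>
      by (intro Henstock_Kurzweil_Integration.integral_combine) (auto simp: absolutely_integrable_on_def)
    have "integral {c..\<sigma>} ?g = integral {a..\<sigma>} ?g - integral {a..c} ?g"
      unfolding comb[symmetric] by (rule add_diff_cancel_left'[symmetric])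
    then show ?thesis using x[of \<sigma>] x[of c] assms(2,3) \<sigma> by simp
  qed
  then show ?thesis unfolding solves_ode_iff using int[of c d] assms by blast
qed

lemma solves_ode_join:
  assumes "a \<le> b" "b \<le> c" "solves_ode f a b x u" "solves_ode f b c x u"
  shows "solves_ode f a c x u"
proof -
  let ?g = "\<lambda>t. f (x t, u t)"
  have g: "?g absolutely_integrable_on {a..c}"
    using assms unfolding solves_ode_iff by (intro absolutely_integrable_on_join[of a b c]) auto
  have "integral {a..\<sigma>} ?g = x \<sigma> - x a" if \<sigma>: "\<sigma> \<in> {a..c}" for \<sigma>
  proof (cases "\<sigma> \<le> b")
    case True
    then show ?thesis using assms(3) \<sigma> unfolding solves_ode_iff by auto
  next
    case False
    have "?g absolutely_integrable_on {a..\<sigma>}"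
      using \<sigma> by (intro absolutely_integrable_on_subinterval[OF g]) auto
    then have "integral {a..b} ?g + integral {b..\<sigma>} ?g = integral {a..\<sigma>} ?g"
      using assms(1,2) False
      by (intro Henstock_Kurzweil_Integration.integral_combine) (auto simp: absolutely_integrable_on_def)
    moreover have "integral {a..b} ?g = x b - x a" "integral {b..\<sigma>} ?g = x \<sigma> - x b"
      using assms \<sigma> False unfolding solves_ode_iff by auto
    ultimately show ?thesis by simp
  qed
  then show ?thesis unfolding solves_ode_iff using g by blast
qed

text \<open>The control enters only under the integral, where the single point \<open>b\<close> has
  no weight; the state at \<open>b\<close> is also read pointwise, so the states must agree on the
  closed interval.\<close>

lemma solves_ode_cong:
  assumes "solves_ode f a b x u"
    and x: "\<And>t. t \<in> {a..b} \<Longrightarrow> x t = y t" and u: "\<And>t. t \<in> {a..<b} \<Longrightarrow> u t = v t"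
  shows "solves_ode f a b y v"
proof -
  have "(\<lambda>t. f (y t, v t)) absolutely_integrable_on {a..b}"
  proof (rule absolutely_integrable_spike)
    show "(\<lambda>t. f (x t, u t)) absolutely_integrable_on {a..b}"
      using assms(1) unfolding solves_ode_iff by blast
    show "f (y t, v t) = f (x t, u t)" if "t \<in> {a..b} - {b}" for t
      using that x[of t] u[of t] by auto
  qed simp
  moreover have "integral {a..\<sigma>} (\<lambda>t. f (y t, v t)) = y \<sigma> - y a" if \<sigma>: "\<sigma> \<in> {a..b}" for \<sigma>
  proof -
    have "f (y t, v t) = f (x t, u t)" if "t \<in> {a..\<sigma>} - {b}" for t
      using that \<sigma> x[of t] u[of t] by auto
    then have "integral {a..\<sigma>} (\<lambda>t. f (y t, v t)) = integral {a..\<sigma>} (\<lambda>t. f (x t, u t))"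
      by (intro integral_spike[of "{b}"]) auto
    also have "\<dots> = x \<sigma> - x a" using assms(1) \<sigma> unfolding solves_ode_iff by blast
    finally show ?thesis using x[of \<sigma>] x[of a] \<sigma> by simp
  qed
  ultimately show ?thesis unfolding solves_ode_iff by blast
qed

lemma solves_ode_shift:
  assumes "solves_ode f a b x u"
  shows "solves_ode f (a - c) (b - c) (\<lambda>t. x (t + c)) (\<lambda>t. u (t + c))"
proof -
  have "integral {a - c..\<sigma>} (\<lambda>t. f (x (t + c), u (t + c))) = x (\<sigma> + c) - x a"
    if "\<sigma> \<in> {a - c..b - c}" for \<sigma>
    using assms that integral_shift_real_ivl[of a c "\<sigma> + c" "\<lambda>t. f (x t, u t)"]
    unfolding solves_ode_iff by auto
  moreover have "(\<lambda>t. f (x (t + c), u (t + c))) absolutely_integrable_on {a - c..b - c}"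
    using assms absolutely_integrable_on_shift[of a b "\<lambda>t. f (x t, u t)" c]
    unfolding solves_ode_iff by blast
  ultimately show ?thesis unfolding solves_ode_iff by simp
qed

section \<open>Admissible trajectories\<close>

lemma admissible_trajectory_subinterval:
  assumes "admissible_trajectory f Xfree U a b x u" "a \<le> c" "d \<le> b"
  shows "admissible_trajectory f Xfree U c d x u"
  using assms admissible_control_subinterval solves_ode_subinterval
  unfolding admissible_trajectory_def by fastforce

lemma admissible_trajectory_join:
  assumes "a \<le> b" "b \<le> c" "admissible_trajectory f Xfree U a b x u"
    "admissible_trajectory f Xfree U b c x u"
  shows "admissible_trajectory f Xfree U a c x u"
  using assms admissible_control_join[OF assms(1,2)] solves_ode_join[OF assms(1,2)]
  unfolding admissible_trajectory_def by (metis atLeastAtMost_iff linear)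

text \<open>The final value of the control is left free because a splice switches controls there.\<close>

lemma admissible_trajectory_cong:
  assumes "admissible_trajectory f Xfree U a b x u"
    and "\<And>t. t \<in> {a..b} \<Longrightarrow> x t = y t" "\<And>t. t \<in> {a..<b} \<Longrightarrow> u t = v t" "v b \<in> U"
  shows "admissible_trajectory f Xfree U a b y v"
proof -
  have "y t \<in> Xfree \<and> v t \<in> U" if "t \<in> {a..b}" for t
    using that assms(1) assms(2)[of t] assms(3)[of t] assms(4) unfolding admissible_trajectory_def
    by (cases "t = b") force+
  then show ?thesis
    using assms admissible_control_cong[of a b u v] solves_ode_cong[of f a b x u y v]
    unfolding admissible_trajectory_def by blast
qed

lemma admissible_trajectory_shift:
  assumes "admissible_trajectory f Xfree U a b x u"
  shows "admissible_trajectory f Xfree U (a - c) (b - c) (\<lambda>t. x (t + c)) (\<lambda>t. u (t + c))"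
  using assms admissible_control_shift[of a b u c] solves_ode_shift[of f a b x u c]
  unfolding admissible_trajectory_def by auto

section \<open>Running cost along admissible trajectories\<close>

text \<open>The state is continuous and the control essentially bounded, so almost every pair lies
  in a compact set, on which the continuous \<open>l\<close> is bounded. A bounded measurable
  function on an interval of finite measure is integrable.\<close>

lemma running_cost_integrable:
  fixes l :: "(real^'n) \<times> (real^'m) \<Rightarrow> real"
  assumes "admissible_trajectory f Xfree U a b x u" and l: "continuous_on UNIV l"
  shows "(\<lambda>t. l (x t, u t)) integrable_on {a..b}"
proof -
  let ?M = "lebesgue_on {a..b}"
  \<comment> \<open>The integral equation exhibits \<open>x\<close> as an indefinite integral, which
    yields its continuity.\<close>
  have "continuous_on {a..b} (\<lambda>\<tau>. x a + integral {a..\<tau>} (\<lambda>t. f (x t, u t)))"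
    using assms(1) unfolding admissible_trajectory_def solves_ode_iff absolutely_integrable_on_def
    by (intro continuous_intros indefinite_integral_continuous_1) auto
  then have x: "continuous_on {a..b} x"
    by (rule continuous_on_eq)
      (use assms(1) in \<open>auto simp: admissible_trajectory_def solves_ode_iff\<close>)
  obtain B where u: "u \<in> borel_measurable ?M" and B: "AE t in ?M. norm (u t) \<le> B"
    using assms(1) unfolding admissible_trajectory_def admissible_control_def by blast
  have "compact (l ` (x ` {a..b} \<times> cball 0 B))"
    using x l
    by (intro compact_continuous_image compact_Times continuous_on_subset[OF l]) auto
  then obtain C where C: "\<And>y. y \<in> l ` (x ` {a..b} \<times> cball 0 B) \<Longrightarrow> norm y \<le> C"
    using compact_imp_bounded bounded_iff by metis
  have "AE t in ?M. norm (l (x t, u t)) \<le> C"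
    \<comment> \<open>\<open>AE_space\<close> supplies the membership of \<open>t\<close> in the
      interval that places \<open>x t\<close> in the compact image.\<close>
    using B AE_space
  proof eventually_elim
    case (elim t)
    then show ?case by (intro C) auto
  qed
  moreover have "(\<lambda>t. l (x t, u t)) \<in> borel_measurable ?M"
    using continuous_imp_measurable_on_sets_lebesgue[OF x] u
    by (intro borel_measurable_continuous_on[OF l] borel_measurable_Pair) auto
  ultimately have "integrable ?M (\<lambda>t. l (x t, u t))"
    by (intro finite_measure.integrable_const_bound[OF finite_measure_lebesgue_on]) auto
  then show ?thesis
    by (intro integrable_on_lebesgue_on) auto
qed

text \<open>\<open>integral\<close> is 0 on non-integrable functions, so additivity rests on the
  integrability that admissibility and continuity of \<open>l\<close> provide.\<close>

lemma running_cost_combine: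
  assumes "a \<le> b" "b \<le> c" "admissible_trajectory f Xfree U a c x u" "continuous_on UNIV l"
  shows "running_cost l a b x u + running_cost l b c x u = running_cost l a c x u"
  unfolding running_cost_def
  using assms running_cost_integrable
  by (intro Henstock_Kurzweil_Integration.integral_combine) auto

lemma running_cost_cong:
  assumes "\<And>t. t \<in> {a..b} \<Longrightarrow> x t = y t" "\<And>t. t \<in> {a..<b} \<Longrightarrow> u t = v t"
  shows "running_cost l a b x u = running_cost l a b y v"
  unfolding running_cost_def using assms by (intro integral_spike[of "{b}"]) auto

lemma running_cost_shift:
  "running_cost l (a - c) (b - c) (\<lambda>t. x (t + c)) (\<lambda>t. u (t + c)) = running_cost l a b x u"
  unfolding running_cost_def by (rule integral_shift_real_ivl)

text \<open>Comparison with the constant \<open>\<epsilon>\<close>; this is how a bound on the cost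
  becomes a bound on the duration.\<close>

lemma running_cost_ge:
  assumes "admissible_trajectory f Xfree U a b x u" "continuous_on UNIV l" "a \<le> b"
    and "\<And>y v. y \<in> Xfree \<Longrightarrow> v \<in> U \<Longrightarrow> \<epsilon> \<le> l (y, v)"
  shows "\<epsilon> * (b - a) \<le> running_cost l a b x u"
proof -
  have "integral {a..b} (\<lambda>_. \<epsilon>) \<le> running_cost l a b x u"
    unfolding running_cost_def
    using assms running_cost_integrable[OF assms(1,2)]
    by (intro integral_le) (auto simp: admissible_trajectory_def)
  then show ?thesis using assms(3) by (simp add: mult.commute)
qed

section \<open>A single re-planning step\<close>

text \<open>Both plans share the head before \<open>t\<^sub>k\<close>. From there on the new plan
  costs the optimal value of the planning problem and the old plan the value of a candidate.
  Admissibility comes from gluing three pieces whose states match, and the shifted tail keeps the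
  final state.\<close>

lemma RHP_step_invariant:
  assumes step: "RHP_step f l Xfree U t\<^sub>0 t\<^sub>k T xp up tfp xn un tfn"
    and adm: "admissible_trajectory f Xfree U t\<^sub>0 tfp xp up"
    and l: "continuous_on UNIV l"
    and times: "t\<^sub>0 \<le> t\<^sub>k" "0 < T" "t\<^sub>k + T \<le> tfp"
  shows "t\<^sub>k + T \<le> tfn" "xn tfn = xp tfp"
    "admissible_trajectory f Xfree U t\<^sub>0 tfn xn un"
    "running_cost l t\<^sub>0 tfn xn un \<le> running_cost l t\<^sub>0 tfp xp up"
proof -
  obtain x u \<tau> where opt: "RHP_optimal f l Xfree U t\<^sub>0 xp up tfp t\<^sub>k T x u \<tau>"
    and tfn: "tfn = tfp - (\<tau> - (t\<^sub>k + T))"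
    and xn: "xn = splice t\<^sub>k T (\<tau> - (t\<^sub>k + T)) xp x" and un: "un = splice t\<^sub>k T (\<tau> - (t\<^sub>k + T)) up u"
    using step unfolding RHP_step_def Let_def by blast
  \<comment> \<open>The tail of the new plan at time \<open>t\<close> replays the old plan at time
    \<open>t + \<Delta>\<close>; a negative \<open>\<Delta>\<close> lengthens the plan.\<close>
  define \<Delta> where "\<Delta> = \<tau> - (t\<^sub>k + T)"
  have \<tau>: "t\<^sub>0 \<le> \<tau>" "\<tau> \<le> tfp" and x: "x t\<^sub>k = xp t\<^sub>k" "x (t\<^sub>k + T) = xp \<tau>"
    and adm_new: "admissible_trajectory f Xfree U t\<^sub>k (t\<^sub>k + T) x u"
    using opt unfolding RHP_optimal_def RHP_feasible_def by auto
  show le: "t\<^sub>k + T \<le> tfn" using \<tau> tfn by simp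
  show "xn tfn = xp tfp" using \<tau> times tfn by (simp add: xn splice_def)

  have shift: "\<tau> - \<Delta> = t\<^sub>k + T" "tfp - \<Delta> = tfn" by (simp_all add: \<Delta>_def tfn)
  \<comment> \<open>At the switching times \<open>splice\<close> already takes the next piece. The
    initial and reconnection constraints make the states agree there as well, while the controls
    agree only on half-open intervals.\<close>
  have x1: "xp t = xn t" if "t \<in> {t\<^sub>0..t\<^sub>k}" for t
    using that x times by (cases "t = t\<^sub>k") (auto simp: xn splice_def)
  have u1: "up t = un t" if "t \<in> {t\<^sub>0..<t\<^sub>k}" for t
    using that by (auto simp: un splice_def)
  have x2: "x t = xn t" if "t \<in> {t\<^sub>k..t\<^sub>k + T}" for t
    using that x times by (cases "t = t\<^sub>k + T") (auto simp: xn splice_def)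
  have u2: "u t = un t" if "t \<in> {t\<^sub>k..<t\<^sub>k + T}" for t
    using that by (auto simp: un splice_def)
  have x3: "xp (t + \<Delta>) = xn t" and u3: "up (t + \<Delta>) = un t" if "t \<in> {t\<^sub>k + T..tfn}" for t
    using that times by (auto simp: xn un splice_def \<Delta>_def)

  have U: "\<And>t. t \<in> {t\<^sub>0..tfp} \<Longrightarrow> up t \<in> U" "\<And>t. t \<in> {t\<^sub>k..t\<^sub>k + T} \<Longrightarrow> u t \<in> U"
    using adm adm_new unfolding admissible_trajectory_def by auto
  \<comment> \<open>The congruence rule leaves the control at the right end of each piece free, so
    its membership in \<open>U\<close> is checked separately: the three values are
    \<open>u t\<^sub>k\<close>, \<open>up \<tau>\<close> and \<open>up tfp\<close>.\<close>
  have unU: "un t\<^sub>k \<in> U" "un (t\<^sub>k + T) \<in> U" "un tfn \<in> U"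
    using U(2)[of t\<^sub>k] U(1)[of \<tau>] U(1)[of tfp] u2[of t\<^sub>k] u3[of "t\<^sub>k + T"] u3[of tfn] \<tau> times le
    by (auto simp: \<Delta>_def tfn)
  have adm3: "admissible_trajectory f Xfree U (t\<^sub>k + T) tfn xn un"
  proof (rule admissible_trajectory_cong)
    show "admissible_trajectory f Xfree U (t\<^sub>k + T) tfn (\<lambda>t. xp (t + \<Delta>)) (\<lambda>t. up (t + \<Delta>))"
      using admissible_trajectory_shift[OF admissible_trajectory_subinterval[OF adm \<tau>(1) order_refl], of \<Delta>]
      unfolding shift .
  qed (use x3 u3 unU(3) in auto)
  have adm2: "admissible_trajectory f Xfree U t\<^sub>k tfn xn un"
  proof (rule admissible_trajectory_join)
    show "admissible_trajectory f Xfree U t\<^sub>k (t\<^sub>k + T) xn un"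
      by (rule admissible_trajectory_cong[OF adm_new x2 u2 unU(2)])
  qed (use adm3 times le in auto)
  show adm': "admissible_trajectory f Xfree U t\<^sub>0 tfn xn un"
  proof (rule admissible_trajectory_join)
    have old: "admissible_trajectory f Xfree U t\<^sub>0 t\<^sub>k xp up"
      using times by (intro admissible_trajectory_subinterval[OF adm]) auto
    show "admissible_trajectory f Xfree U t\<^sub>0 t\<^sub>k xn un"
      by (rule admissible_trajectory_cong[OF old x1 u1 unU(1)])
  qed (use adm2 times le in auto)

  have tail: "admissible_trajectory f Xfree U t\<^sub>k tfp xp up"
    using times by (intro admissible_trajectory_subinterval[OF adm]) auto
  \<comment> \<open>The last two summands are bracketed because together they become the
    \<open>RHP_cost\<close> of the optimal solution.\<close>
  have "running_cost l t\<^sub>0 tfn xn un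
      = running_cost l t\<^sub>0 t\<^sub>k xn un + (running_cost l t\<^sub>k (t\<^sub>k + T) xn un + running_cost l (t\<^sub>k + T) tfn xn un)"
    using running_cost_combine[OF _ _ adm' l, of t\<^sub>k] running_cost_combine[OF _ _ adm2 l, of "t\<^sub>k + T"]
      times le by simp
  also have "running_cost l t\<^sub>0 t\<^sub>k xn un = running_cost l t\<^sub>0 t\<^sub>k xp up"
    by (rule running_cost_cong[symmetric, OF x1 u1])
  also have "running_cost l t\<^sub>k (t\<^sub>k + T) xn un = running_cost l t\<^sub>k (t\<^sub>k + T) x u"
    by (rule running_cost_cong[symmetric, OF x2 u2])
  also have "running_cost l (t\<^sub>k + T) tfn xn un
      = running_cost l (t\<^sub>k + T) tfn (\<lambda>t. xp (t + \<Delta>)) (\<lambda>t. up (t + \<Delta>))"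
    using x3 u3 by (intro running_cost_cong) auto
  also have "\<dots> = cost_to_go l xp up tfp \<tau>"
    using running_cost_shift[of l \<tau> \<Delta> tfp xp up] unfolding shift cost_to_go_def .
  also have "running_cost l t\<^sub>k (t\<^sub>k + T) x u + cost_to_go l xp up tfp \<tau>
      \<le> running_cost l t\<^sub>k (t\<^sub>k + T) xp up + cost_to_go l xp up tfp (t\<^sub>k + T)"
  proof -
    \<comment> \<open>the previous plan itself is a candidate, with reconnection time \<open>t\<^sub>k + T\<close>\<close>
    have "RHP_feasible f Xfree U t\<^sub>0 xp tfp t\<^sub>k T xp up (t\<^sub>k + T)"
      using times admissible_trajectory_subinterval[OF adm, of t\<^sub>k "t\<^sub>k + T"]
      unfolding RHP_feasible_def by auto
    then show ?thesis using opt unfolding RHP_optimal_def RHP_cost_def by (simp add: add.commute)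
  qed
  also have "running_cost l t\<^sub>0 t\<^sub>k xp up + (running_cost l t\<^sub>k (t\<^sub>k + T) xp up + cost_to_go l xp up tfp (t\<^sub>k + T))
      = running_cost l t\<^sub>0 tfp xp up"
    using running_cost_combine[OF _ _ adm l, of t\<^sub>k] times
      running_cost_combine[OF _ _ tail l, of "t\<^sub>k + T"]
    unfolding cost_to_go_def by simp
  finally show "running_cost l t\<^sub>0 tfn xn un \<le> running_cost l t\<^sub>0 tfp xp up" by simp
qed

section \<open>The whole sequence of plans\<close>

text \<open>Each index either performs a step as above or keeps its plan. Comparing with plan 0
  makes the cost bound uniform in \<open>k\<close>; \<open>t\<^sub>0 \<le> tf k\<close> is carried
  along because the lower bound on the cost requires ordered endpoints.\<close>

lemma RHP_run_invariant:
  assumes run: "RHP_run f l Xfree U t\<^sub>0 \<delta> T xbar ubar tf"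
    and nominal: "feasible_P f Xfree U t\<^sub>0 x\<^sub>0 x\<^sub>f (xbar 0) (ubar 0) (tf 0)"
    and l: "continuous_on UNIV l" and horizon: "0 < \<delta>" "\<delta> < T"
  shows "t\<^sub>0 \<le> tf k \<and> xbar k (tf k) = x\<^sub>f \<and>
    admissible_trajectory f Xfree U t\<^sub>0 (tf k) (xbar k) (ubar k) \<and>
    running_cost l t\<^sub>0 (tf k) (xbar k) (ubar k) \<le> running_cost l t\<^sub>0 (tf 0) (xbar 0) (ubar 0)"
proof (induction k)
  case 0
  then show ?case using nominal unfolding feasible_P_def by auto
next
  case (Suc k)
  show ?case
  proof (cases "plan_time t\<^sub>0 \<delta> k + T \<le> tf k")
    case True
    then have step: "RHP_step f l Xfree U t\<^sub>0 (plan_time t\<^sub>0 \<delta> k) T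
        (xbar k) (ubar k) (tf k) (xbar (Suc k)) (ubar (Suc k)) (tf (Suc k))"
      using run unfolding RHP_run_def by meson
    have adm: "admissible_trajectory f Xfree U t\<^sub>0 (tf k) (xbar k) (ubar k)" using Suc by blast
    have t: "t\<^sub>0 \<le> plan_time t\<^sub>0 \<delta> k" using horizon by (simp add: plan_time_def)
    have "0 < T" using horizon by simp
    from RHP_step_invariant[OF step adm l t this True] show ?thesis
      using Suc t \<open>0 < T\<close> by (auto intro: order_trans)
  next
    case False
    then have "xbar (Suc k) = xbar k \<and> ubar (Suc k) = ubar k \<and> tf (Suc k) = tf k"
      using run unfolding RHP_run_def by meson
    then show ?thesis using Suc by simp
  qed
qed

section \<open>Termination of re-planning and arrival at the terminal state\<close>

text \<open>The witness \<open>N\<close> counts the iterations performed, so plan \<open>N\<close>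
  is the last one computed (the nominal one if \<open>N = 0\<close>) and \<open>tf N\<close> is a
  finite arrival time.\<close>

theorem corollary1:
  fixes f :: "(real^'n) \<times> (real^'m) \<Rightarrow> real^'n"
    and l :: "(real^'n) \<times> (real^'m) \<Rightarrow> real"
    and X Xobst Xfree :: "(real^'n) set" and U :: "(real^'m) set"
    and x\<^sub>0 x\<^sub>f :: "real^'n"
    and t\<^sub>0 \<delta> T Tmax \<epsilon> :: real
    and xbar :: "nat \<Rightarrow> real \<Rightarrow> real^'n" and ubar :: "nat \<Rightarrow> real \<Rightarrow> real^'m" and tf :: "nat \<Rightarrow> real"
    and x :: "real \<Rightarrow> real^'n" and u :: "real \<Rightarrow> real^'m"
  assumes Xfree: "Xfree = X - Xobst"
    and x0: "x\<^sub>0 \<in> Xfree" and xf: "x\<^sub>f \<in> Xfree"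
    and horizon: "0 < \<delta>" "\<delta> < T" "T \<le> Tmax"
    and nominal: "feasible_P f Xfree U t\<^sub>0 x\<^sub>0 x\<^sub>f (xbar 0) (ubar 0) (tf 0)"
    and run: "RHP_run f l Xfree U t\<^sub>0 \<delta> T xbar ubar tf"
    and executed: "RHP_executed t\<^sub>0 \<delta> xbar ubar tf x u"
    and cont: "continuous_on UNIV l"
    and eps: "0 < \<epsilon>" "\<And>y v. y \<in> X \<Longrightarrow> v \<in> U \<Longrightarrow> \<epsilon> \<le> l (y, v)"
  shows "\<exists>N. (\<forall>k<N. plan_time t\<^sub>0 \<delta> k + T \<le> tf k) \<and> tf N < plan_time t\<^sub>0 \<delta> N + T \<and>
             t\<^sub>0 \<le> tf N \<and> x (tf N) = x\<^sub>f"
proof -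
  let ?t = "plan_time t\<^sub>0 \<delta>"
  note inv = RHP_run_invariant[OF run nominal cont horizon(1,2)]
  define J where "J = running_cost l t\<^sub>0 (tf 0) (xbar 0) (ubar 0)"
  have bound: "tf k \<le> t\<^sub>0 + J / \<epsilon>" for k
  proof -
    have "\<epsilon> * (tf k - t\<^sub>0) \<le> running_cost l t\<^sub>0 (tf k) (xbar k) (ubar k)"
      using inv[of k] Xfree eps(2) cont by (intro running_cost_ge) auto
    also have "\<dots> \<le> J" using inv[of k] unfolding J_def by simp
    finally show ?thesis using eps(1) by (simp add: field_simps)
  qed
  \<comment> \<open>For this \<open>k\<close> the planning time alone exceeds the uniform bound on
    all terminal times.\<close>
  obtain k where "J / \<epsilon> < real k * \<delta>" using reals_Archimedean3[OF horizon(1)] by blast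
  then have "\<exists>k. tf k < ?t k + T" using bound[of k] horizon by (auto simp: plan_time_def intro!: exI[of _ k])
  \<comment> \<open>Minimality of \<open>N\<close> says that every earlier iteration is carried
    out.\<close>
  then obtain N where stop: "tf N < ?t N + T" and "\<And>k. k < N \<Longrightarrow> \<not> tf k < ?t k + T"
    using exists_least_iff[of "\<lambda>k. tf k < ?t k + T"] by blast
  then have go: "?t k + T \<le> tf k" if "k < N" for k using that by force
  have t_mono: "?t i \<le> ?t j" if "i \<le> j" for i j
    using that horizon(1) by (simp add: plan_time_def)
  have kept: "xbar j = xbar N \<and> tf j = tf N" if "N \<le> j" for j
    using that
  proof (induction j rule: dec_induct)
    case (step j)
    then have "\<not> ?t j + T \<le> tf j" using stop t_mono[of N j] by simp
    then show ?case using run step.IH unfolding RHP_run_def by metis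
  qed simp
  \<comment> \<open>If \<open>tf N\<close> preceded planning time \<open>N\<close>, an earlier plan
    could be the one in execution then. After a last step at \<open>M\<close>, the new plan reaches
    at least \<open>T\<close> beyond \<open>?t M\<close>, and \<open>\<delta> < T\<close> carries
    this past \<open>?t N\<close>.\<close>
  have late: "?t N \<le> tf N"
  proof (cases N)
    case 0
    then show ?thesis using inv[of 0] by (simp add: plan_time_def)
  next
    case (Suc M)
    have step: "RHP_step f l Xfree U t\<^sub>0 (?t M) T (xbar M) (ubar M) (tf M) (xbar N) (ubar N) (tf N)"
      using run go[of M] Suc unfolding RHP_run_def by (metis lessI)
    have "?t M + T \<le> tf N"
      using RHP_step_invariant(1)[OF step _ cont] inv[of M] go[of M] Suc horizon t_mono[of 0 M]
      by (simp add: plan_time_def)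
    then show ?thesis using horizon Suc by (simp add: plan_time_def algebra_simps)
  qed
  \<comment> \<open>hence the plan in execution at time \<open>tf N\<close> is the final one\<close>
  define k where "k = nat \<lfloor>(tf N - t\<^sub>0) / \<delta>\<rfloor>"
  \<comment> \<open>Nonnegativity keeps \<open>nat\<close> from truncating the floor, so
    \<open>tf N\<close> falls in the half-open slot from planning time \<open>k\<close> to
    \<open>Suc k\<close>.\<close>
  have nonneg: "0 \<le> (tf N - t\<^sub>0) / \<delta>" using inv[of N] horizon by simp
  then have "real k \<le> (tf N - t\<^sub>0) / \<delta>" "(tf N - t\<^sub>0) / \<delta> < real k + 1"
    unfolding k_def by (simp, linarith)
  then have k: "?t k \<le> tf N" "tf N < ?t (Suc k)"
    using horizon(1) by (auto simp: plan_time_def field_simps)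
  \<comment> \<open>Otherwise \<open>Suc k \<le> N\<close>, and
    \<open>tf N < ?t (Suc k) \<le> ?t N \<le> tf N\<close> is a contradiction.\<close>
  have "N \<le> k"
    using k(2) late t_mono[of "Suc k" N] by (meson not_less not_less_eq_eq order.strict_trans2)
  then have "xbar (Suc k) = xbar N" "tf (Suc k) = tf N" using kept[of "Suc k"] by auto
  \<comment> \<open>In slot \<open>k\<close> plan \<open>Suc k\<close> is executed up to and
    including its end; the required \<open>tf N \<le> tf (Suc k)\<close> holds with
    equality.\<close>
  then have "x (tf N) = x\<^sub>f"
    using executed k inv[of N] unfolding RHP_executed_def by (metis order_refl)
  then show ?thesis using stop go inv[of N] by blast
qed

end
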